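(* Let $p$ be a prime, let $f \in \mathbb{Z}_p[x]$ be a polynomial, and let $x_n = f(n)$ for $n \in \mathbb{N} = \{1,2,3,\ldots\}$. Then $D_N(x_n) = \mathcal{O}\left(\frac{1}{N}\right)$ (as $N \to \infty$) if and only if $f$ is a permutation polynomial $\bmod\ p$ and $\bmod\ p^2$.
   Context: $\mathbb{Z}_p$ is the ring of $p$-adic integers and $|\cdot|_p$ the $p$-adic absolute value, normalized by $|p|_p = p^{-1}$. For $z \in \mathbb{Z}_p$ and $k \in \mathbb{N}$ put $D_p(z,p^{-k}) = \{x \in \mathbb{Z}_p : |x-z|_p \le p^{-k}\}$. For a sequence $(x_n)_{n\in\mathbb{N}} \subset \mathbb{Z}_p$ and $N \in \mathbb{N}$, the $p$-adic discrepancy is $$D_N(x_n) := \sup_{z \in \mathbb{Z}_p,\, k \in \mathbb{N}} \left| \frac{\#\left(D_p(z,p^{-k}) \cap \{x_1,\ldots,x_N\}\right)}{N} - \frac{1}{p^k} \right|,$$ where the elements of the sequence are counted with multiplicity, i.e. the numerator is the number of indices $1 \le n \le N$ with $x_n \in D_p(z,p^{-k})$. A polynomial $f \in \mathbb{Z}_p[x]$ is called a permutation polynomial $\bmod\ p^k$ if the map it induces on $\mathbb{Z}_p/p^k\mathbb{Z}_p \cong \mathbb{Z}/p^k\mathbb{Z}$ is a bijection. *)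

theory Defs
  imports
    "HOL-Algebra.Polynomials"
    "HOL-Computational_Algebra.Primes"
    "HOL-Library.Landau_Symbols"
begin

text \<open>
  The ring of \<open>p\<close>-adic integers as the inverse limit of the rings \<open>\<int>/p\<^sup>k\<int>\<close>: an element \<open>x\<close> is a
  coherent sequence of residues, \<open>x k\<close> being the residue modulo \<open>p ^ k\<close> in \<open>{0..<p ^ k}\<close>.
\<close>

definition padic_ring :: "nat \<Rightarrow> (nat \<Rightarrow> int) ring" where
  "padic_ring p =
     \<lparr>carrier = {x. \<forall>k. x k \<in> {0..<int p ^ k} \<and> x (Suc k) mod int p ^ k = x k},
      mult = (\<lambda>x y k. (x k * y k) mod int p ^ k),
      one = (\<lambda>k. 1 mod int p ^ k),
      zero = (\<lambda>k. 0),
      add = (\<lambda>x y k. (x k + y k) mod int p ^ k)\<rparr>"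

definition padic_of_nat :: "nat \<Rightarrow> nat \<Rightarrow> (nat \<Rightarrow> int)" where
  "padic_of_nat p n = [n] \<cdot>\<^bsub>padic_ring p\<^esub> \<one>\<^bsub>padic_ring p\<^esub>"

text \<open>\<open>GREATEST\<close> is a genuine maximum here, since a nonzero element is divisible by only finitely
  many powers of \<open>p\<close>.\<close>

definition padic_val :: "nat \<Rightarrow> (nat \<Rightarrow> int) \<Rightarrow> nat" where
  "padic_val p x = (GREATEST k. padic_of_nat p (p ^ k) divides\<^bsub>padic_ring p\<^esub> x)"

definition padic_abs :: "nat \<Rightarrow> (nat \<Rightarrow> int) \<Rightarrow> real" where
  "padic_abs p x = (if x = \<zero>\<^bsub>padic_ring p\<^esub> then 0 else 1 / real p ^ padic_val p x)"

definition padic_disc :: "nat \<Rightarrow> (nat \<Rightarrow> int) \<Rightarrow> real \<Rightarrow> (nat \<Rightarrow> int) set" where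
  "padic_disc p z r = {x \<in> carrier (padic_ring p). padic_abs p (x \<ominus>\<^bsub>padic_ring p\<^esub> z) \<le> r}"

text \<open>Sequences are indexed from 1, and their terms are counted with multiplicity; the exponent
  \<open>k\<close> ranges over the positive integers.\<close>

definition padic_discrepancy :: "nat \<Rightarrow> (nat \<Rightarrow> (nat \<Rightarrow> int)) \<Rightarrow> nat \<Rightarrow> real" where
  "padic_discrepancy p x N =
     (SUP (z, k) \<in> carrier (padic_ring p) \<times> {1..}.
        \<bar>real (card {n \<in> {1..N}. x n \<in> padic_disc p z (1 / real p ^ k)}) / real N
           - 1 / real p ^ k\<bar>)"

text \<open>The map induced by \<open>f\<close> on \<open>\<int>\<^sub>p/p\<^sup>k\<int>\<^sub>p\<close> is evaluation of \<open>f\<close> with its coefficients reduced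
  modulo \<open>p\<^sup>k\<int>\<^sub>p\<close>; see \<open>eval_reduced_polynomial\<close> below.\<close>

definition perm_poly_mod_power :: "nat \<Rightarrow> (nat \<Rightarrow> int) list \<Rightarrow> nat \<Rightarrow> bool" where
  "perm_poly_mod_power p f k \<longleftrightarrow>
     (let R = padic_ring p; I = PIdl\<^bsub>R\<^esub> (padic_of_nat p (p ^ k)); Q = R Quot I
      in bij_betw (ring.eval Q (map (\<lambda>c. I +>\<^bsub>R\<^esub> c) f)) (carrier Q) (carrier Q))"


lemma padic_carrier_iff:
  "x \<in> carrier (padic_ring p) \<longleftrightarrow>
     (\<forall>k. 0 \<le> x k \<and> x k < int p ^ k \<and> x (Suc k) mod int p ^ k = x k)"
  by (auto simp: padic_ring_def)

lemma padic_simps: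
  "x \<otimes>\<^bsub>padic_ring p\<^esub> y = (\<lambda>k. (x k * y k) mod int p ^ k)"
  "x \<oplus>\<^bsub>padic_ring p\<^esub> y = (\<lambda>k. (x k + y k) mod int p ^ k)"
  "\<one>\<^bsub>padic_ring p\<^esub> = (\<lambda>k. 1 mod int p ^ k)"
  "\<zero>\<^bsub>padic_ring p\<^esub> = (\<lambda>k. 0)"
  by (simp_all add: padic_ring_def)

lemma padic_closedI:
  assumes "p > 0" and "\<And>k. g (Suc k) mod int p ^ k = g k mod int p ^ k"
  shows "(\<lambda>k. g k mod int p ^ k) \<in> carrier (padic_ring p)"
  using assms by (auto simp: padic_carrier_iff mod_mod_cancel le_imp_power_dvd)

lemma padic_residue:
  assumes "x \<in> carrier (padic_ring p)"
  shows "x k mod int p ^ k = x k"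
  using assms by (simp add: padic_carrier_iff)

lemma padic_mod_le:
  assumes "x \<in> carrier (padic_ring p)" and "j \<le> k"
  shows "x k mod int p ^ j = x j"
  using assms(2)
proof (induction k rule: dec_induct)
  case base
  then show ?case using assms(1) by (rule padic_residue)
next
  case (step k)
  have "x (Suc k) mod int p ^ j = (x (Suc k) mod int p ^ k) mod int p ^ j"
    using step by (simp add: mod_mod_cancel le_imp_power_dvd)
  also have "\<dots> = x j" using step assms(1) by (simp add: padic_carrier_iff)
  finally show ?case .
qed

lemma padic_cring:
  assumes p: "p > 0"
  shows "cring (padic_ring p)"
proof -
  let ?R = "padic_ring p"
  have S: "x (Suc k) mod int p ^ k = x k mod int p ^ k" if "x \<in> carrier ?R" for x k
    using that by (simp add: padic_carrier_iff)
  have addc: "x \<oplus>\<^bsub>?R\<^esub> y \<in> carrier ?R" if "x \<in> carrier ?R" "y \<in> carrier ?R" for x y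
    unfolding padic_simps using that p by (intro padic_closedI mod_add_cong S)
  have mulc: "x \<otimes>\<^bsub>?R\<^esub> y \<in> carrier ?R" if "x \<in> carrier ?R" "y \<in> carrier ?R" for x y
    unfolding padic_simps using that p by (intro padic_closedI mod_mult_cong S)
  have onec: "\<one>\<^bsub>?R\<^esub> \<in> carrier ?R" unfolding padic_simps using p by (intro padic_closedI) auto
  have zeroc: "\<zero>\<^bsub>?R\<^esub> \<in> carrier ?R" unfolding padic_simps using p by (simp add: padic_carrier_iff)
  show ?thesis
  proof (rule cringI)
    show "abelian_group ?R"
    proof (rule abelian_groupI)
      fix x assume x: "x \<in> carrier ?R"
      show "\<exists>y\<in>carrier ?R. y \<oplus>\<^bsub>?R\<^esub> x = \<zero>\<^bsub>?R\<^esub>"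
      proof
        show "(\<lambda>k. (- x k) mod int p ^ k) \<in> carrier ?R"
          using x p by (intro padic_closedI mod_minus_cong S)
        show "(\<lambda>k. (- x k) mod int p ^ k) \<oplus>\<^bsub>?R\<^esub> x = \<zero>\<^bsub>?R\<^esub>"
          by (simp add: padic_simps mod_simps)
      qed
      show "\<zero>\<^bsub>?R\<^esub> \<oplus>\<^bsub>?R\<^esub> x = x" using padic_residue[OF x] by (simp add: padic_simps)
    qed (auto simp: addc zeroc, auto simp: padic_simps mod_simps algebra_simps)
    show "comm_monoid ?R"
      by (rule comm_monoidI)
         (auto simp: mulc onec, auto simp: padic_simps mod_simps algebra_simps padic_residue)
  qed (auto simp: padic_simps mod_simps algebra_simps)
qed

lemma padic_of_nat_eq: "padic_of_nat p n = (\<lambda>k. int n mod int p ^ k)" if "p > 0"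
proof -
  interpret cring "padic_ring p" using that by (rule padic_cring)
  show ?thesis unfolding padic_of_nat_def
    by (induction n) (auto simp: padic_simps mod_simps algebra_simps)
qed

lemma padic_of_nat_closed: "padic_of_nat p n \<in> carrier (padic_ring p)" if "p > 0"
proof -
  interpret cring "padic_ring p" using that by (rule padic_cring)
  show ?thesis unfolding padic_of_nat_def by simp
qed

lemma padic_power_divides_iff:
  assumes p: "p > 0" and x: "x \<in> carrier (padic_ring p)"
  shows "padic_of_nat p (p ^ k) divides\<^bsub>padic_ring p\<^esub> x \<longleftrightarrow> x k = 0"
proof
  assume "padic_of_nat p (p ^ k) divides\<^bsub>padic_ring p\<^esub> x"
  then obtain y where "x = padic_of_nat p (p ^ k) \<otimes>\<^bsub>padic_ring p\<^esub> y"
    by (auto simp: factor_def)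
  then show "x k = 0" using p by (simp add: padic_of_nat_eq padic_simps)
next
  assume xk: "x k = 0"
  let ?q = "int p ^ k"
  define y where "y = (\<lambda>j. x (j + k) div ?q)"
  have dvd: "?q dvd x (j + k)" for j
    using padic_mod_le[OF x, of k "j + k"] xk by (simp add: mod_0_imp_dvd)
  then have y: "?q * y j = x (j + k)" for j by (simp add: y_def)
  have pos: "?q > 0" using p by simp
  have "y \<in> carrier (padic_ring p)"
    unfolding padic_carrier_iff
  proof (intro allI conjI)
    fix j
    have b: "0 \<le> x (j + k)" "x (j + k) < ?q * int p ^ j"
      using x by (auto simp: padic_carrier_iff mult.commute simp flip: power_add)
    show "0 \<le> y j" using b pos by (simp add: y_def pos_imp_zdiv_nonneg_iff)
    have "?q * y j < ?q * int p ^ j" using b y by simp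
    then show "y j < int p ^ j" using pos by (simp add: mult_less_cancel_left_pos)
    have "?q * (y (Suc j) mod int p ^ j) = x (Suc (j + k)) mod (int p ^ (j + k))"
      using y[of "Suc j"] by (simp add: mult_mod_right power_add mult.commute)
    also have "\<dots> = ?q * y j" using x y by (simp add: padic_carrier_iff)
    finally show "y (Suc j) mod int p ^ j = y j" using p by simp
  qed
  moreover have "x = padic_of_nat p (p ^ k) \<otimes>\<^bsub>padic_ring p\<^esub> y"
  proof
    fix j
    have "x j = x (j + k) mod int p ^ j" using padic_mod_le[OF x, of j "j + k"] by simp
    also have "\<dots> = (int (p ^ k) mod int p ^ j * y j) mod int p ^ j"
      using y[of j] by (simp add: mod_simps)
    finally show "x j = (padic_of_nat p (p ^ k) \<otimes>\<^bsub>padic_ring p\<^esub> y) j"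
      using p by (simp add: padic_of_nat_eq padic_simps)
  qed
  ultimately show "padic_of_nat p (p ^ k) divides\<^bsub>padic_ring p\<^esub> x" by (auto simp: factor_def)
qed

lemma padic_abs_p:
  assumes "p > 1"
  shows "padic_abs p (padic_of_nat p p) = 1 / real p"
proof -
  have p0: "p > 0" using assms by simp
  have e: "padic_of_nat p p k = int p mod int p ^ k" for k using p0 by (simp add: padic_of_nat_eq)
  have n0: "int p mod int p ^ k \<noteq> 0" if "k > 1" for k
  proof -
    have "int p ^ 1 < int p ^ k" using that assms by (intro power_strict_increasing) auto
    then show ?thesis using assms by simp
  qed
  have "padic_val p (padic_of_nat p p) = 1"
    unfolding padic_val_def padic_power_divides_iff[OF p0 padic_of_nat_closed[OF p0]] e
  proof (rule Greatest_equality)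
    show "k \<le> 1" if "int p mod int p ^ k = 0" for k
      using n0[of k] that by linarith
  qed simp
  moreover have "padic_of_nat p p \<noteq> \<zero>\<^bsub>padic_ring p\<^esub>"
    using e[of 2] n0[of 2] by (auto simp: padic_simps)
  ultimately show ?thesis by (simp add: padic_abs_def)
qed

lemma (in cring) eval_reduced_polynomial:
  assumes I: "ideal I R" and f: "set f \<subseteq> carrier R" and x: "x \<in> carrier R"
  shows "ring.eval (R Quot I) (map (\<lambda>c. I +> c) f) (I +> x) = I +> eval f x"
proof -
  interpret h: ring_hom_ring R "R Quot I" "\<lambda>c. I +> c"
    using I by (rule ideal.rcos_ring_hom_ring)
  show ?thesis using h.eval_hom'[OF x f] by simp
qed

end

theory Submission
  imports
    Defs
    "HOL-Computational_Algebra.Polynomial"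
    "HOL-Number_Theory.Cong"
begin

text \<open>
  Two ideas carry the proof.

  If \<open>f\<close> does not permute the residues modulo \<open>p ^ k\<close>, then, the residues being finite in number,
  it misses one of them. The corresponding disc contains no term of the sequence at all, so its
  local discrepancy is \<open>1 / p ^ k\<close> for every \<open>N\<close>, and the discrepancy does not even tend to \<open>0\<close>.
  Applied to \<open>k = 1\<close> and \<open>k = 2\<close>, this is the direction from left to right.

  Conversely, suppose that \<open>f\<close> permutes the residues modulo \<open>p\<close> and modulo \<open>p ^ 2\<close>. The expansion
  \<open>f (a + h) = f a + h * f' a + h ^ 2 * e\<close> with \<open>h = p\<close> shows that \<open>f'\<close> has no zero modulo \<open>p\<close>, as
  otherwise \<open>a\<close> and \<open>a + p\<close> would collide modulo \<open>p ^ 2\<close>; and the same expansion with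
  \<open>h = p ^ k * t\<close> then lifts injectivity from \<open>p ^ k\<close> to \<open>p ^ (k + 1)\<close>
  (\<open>inj_mod_all_prime_powers\<close>). Hence for every \<open>k\<close> the indices \<open>n\<close> with \<open>f n\<close> in a given disc of
  radius \<open>1 / p ^ k\<close> form exactly one residue class modulo \<open>p ^ k\<close>, and such a class has
  \<open>N / p ^ k\<close> members up to \<open>N\<close>, with an error of at most \<open>1\<close> that is uniform in \<open>k\<close>
  (\<open>card_residue_class\<close>).

  The two halves meet in the description of \<open>\<int>\<^sub>p\<close> by residues: membership in a disc, evaluation of
  \<open>f\<close> and the quotient by \<open>p\<^sup>k\<int>\<^sub>p\<close> depend only on the \<open>k\<close>-th residues, so that everything is a
  statement about integer polynomials modulo \<open>p ^ k\<close>.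
\<close>

section \<open>Integer polynomials modulo prime powers\<close>

definition inj_mod :: "int poly \<Rightarrow> int \<Rightarrow> bool" where
  "inj_mod P q \<longleftrightarrow> (\<forall>a b. [poly P a = poly P b] (mod q) \<longrightarrow> [a = b] (mod q))"

lemma poly_taylor_order2:
  fixes P :: "'a :: idom poly"
  shows "\<exists>e. poly P (a + h) = poly P a + h * poly (pderiv P) a + h\<^sup>2 * e"
proof (induction P)
  case 0
  then show ?case by simp
next
  case (pCons c P)
  from pCons(2) obtain e
    where e: "poly P (a + h) = poly P a + h * poly (pderiv P) a + h\<^sup>2 * e" ..
  show ?case
    by (rule exI[of _ "poly (pderiv P) a + (a + h) * e"])
       (simp add: e pderiv_pCons algebra_simps power2_eq_square)
qed

lemma poly_cong_arg:
  fixes P :: "int poly"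
  assumes "[a = b] (mod q)"
  shows "[poly P a = poly P b] (mod q)"
  by (induction P) (auto intro!: cong_add cong_mult assms)

text \<open>
  This is Hensel lifting without limits. Injectivity modulo \<open>p ^ 2\<close> is used to keep the derivative
  away from \<open>0\<close> modulo \<open>p\<close>. A collision of \<open>a\<close> and \<open>b\<close> modulo \<open>p ^ (k + 1)\<close> is also one modulo
  \<open>p ^ k\<close>, so that \<open>b = a + p ^ k * t\<close>, and to first order the values at \<open>a\<close> and \<open>b\<close> differ by
  \<open>p ^ k * t\<close> times the derivative; this forces \<open>p\<close> to divide \<open>t\<close>.
\<close>

lemma inj_mod_all_prime_powers:
  fixes P :: "int poly"
  assumes p: "Factorial_Ring.prime p"
    and inj1: "inj_mod P (int p ^ 1)" and inj2: "inj_mod P (int p ^ 2)"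
    and k: "k \<ge> 1"
  shows "inj_mod P (int p ^ k)"
proof -
  have pp: "prime (int p)" using p by simp
  have p1: "int p > 1" using p prime_gt_1_nat by auto
  have deriv: "\<not> int p dvd poly (pderiv P) a" for a
  proof
    assume "int p dvd poly (pderiv P) a"
    then obtain d where d: "poly (pderiv P) a = int p * d" ..
    obtain e where "poly P (a + int p) = poly P a + int p * poly (pderiv P) a + (int p)\<^sup>2 * e"
      using poly_taylor_order2 by blast
    then have "poly P (a + int p) = poly P a + (int p)\<^sup>2 * (d + e)"
      by (simp add: d algebra_simps power2_eq_square)
    then have "[poly P (a + int p) = poly P a] (mod int p ^ 2)"
      by (simp add: cong_iff_dvd_diff)
    with inj2 have "[a + int p = a] (mod int p ^ 2)" unfolding inj_mod_def by blast
    then have "int p ^ 2 dvd int p ^ 1" by (simp add: cong_iff_dvd_diff)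
    then show False using p1 by (subst (asm) dvd_power_iff) auto
  qed
  show ?thesis using k
  proof (induction k rule: dec_induct)
    case base
    then show ?case using inj1 by simp
  next
    case (step k)
    show ?case unfolding inj_mod_def
    proof (intro allI impI)
      fix a b assume ab: "[poly P a = poly P b] (mod int p ^ Suc k)"
      then have "[poly P b = poly P a] (mod int p ^ k)"
        by (meson cong_dvd_modulus cong_sym le_imp_power_dvd le_SucI order_refl)
      with step.IH have "[b = a] (mod int p ^ k)" unfolding inj_mod_def by blast
      then obtain t where t: "b = a + int p ^ k * t"
        by (metis cong_iff_lin cong_sym)
      obtain e where "poly P b = poly P a + (int p ^ k * t) * poly (pderiv P) a
          + (int p ^ k * t)\<^sup>2 * e"
        using poly_taylor_order2 t by blast
      then have diff: "poly P b - poly P a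
          = int p ^ k * (t * poly (pderiv P) a + int p ^ k * t\<^sup>2 * e)"
        by (simp add: algebra_simps power2_eq_square)
      have "int p ^ k * int p dvd poly P b - poly P a"
        using cong_sym[OF ab] by (simp add: cong_iff_dvd_diff mult.commute)
      then have "int p dvd t * poly (pderiv P) a + int p ^ k * t\<^sup>2 * e"
        unfolding diff using p1 by simp
      \<comment> \<open>The quadratic term vanishes modulo \<open>p\<close> because \<open>k \<ge> 1\<close>.\<close>
      moreover have "int p dvd int p ^ k * t\<^sup>2 * e"
        using step.hyps by (simp add: dvd_power)
      ultimately have "int p dvd t * poly (pderiv P) a" by (simp add: dvd_add_left_iff)
      with deriv[of a] pp have "int p dvd t" by (auto simp: prime_dvd_mult_iff)
      then have "int p ^ Suc k dvd int p ^ k * t" by (simp add: mult.commute mult_dvd_mono)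
      then show "[a = b] (mod int p ^ Suc k)"
        by (simp add: t cong_iff_dvd_diff)
    qed
  qed
qed

lemma inj_mod_iff_inj_on:
  assumes "q > 0"
  shows "inj_mod P q \<longleftrightarrow> inj_on (\<lambda>a. poly P a mod q) {0..<q}"
proof
  assume "inj_mod P q"
  then show "inj_on (\<lambda>a. poly P a mod q) {0..<q}"
    unfolding inj_mod_def inj_on_def cong_def by (metis atLeastLessThan_iff mod_pos_pos_trivial)
next
  assume inj: "inj_on (\<lambda>a. poly P a mod q) {0..<q}"
  show "inj_mod P q" unfolding inj_mod_def
  proof (intro allI impI)
    fix a b assume ab: "[poly P a = poly P b] (mod q)"
    have "[poly P (a mod q) = poly P a] (mod q)" "[poly P (b mod q) = poly P b] (mod q)"
      by (intro poly_cong_arg; simp)+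
    with ab have "poly P (a mod q) mod q = poly P (b mod q) mod q" by (simp add: cong_def)
    moreover have "a mod q \<in> {0..<q}" "b mod q \<in> {0..<q}" using assms by simp_all
    ultimately have "a mod q = b mod q" by (rule inj_onD[OF inj])
    then show "[a = b] (mod q)" by (simp add: cong_def)
  qed
qed

lemma inj_mod_iff_surj:
  assumes "q > 0"
  shows "inj_mod P q \<longleftrightarrow> (\<forall>c\<in>{0..<q}. \<exists>a. poly P a mod q = c)"
proof -
  let ?F = "\<lambda>a. poly P a mod q"
  have into: "?F ` {0..<q} \<subseteq> {0..<q}" using assms by auto
  have "inj_mod P q \<longleftrightarrow> inj_on ?F {0..<q}" using assms by (rule inj_mod_iff_inj_on)
  also have "\<dots> \<longleftrightarrow> {0..<q} \<subseteq> ?F ` {0..<q}"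
  proof
    assume "inj_on ?F {0..<q}"
    then show "{0..<q} \<subseteq> ?F ` {0..<q}" using endo_inj_surj[OF _ into] by simp
  next
    assume "{0..<q} \<subseteq> ?F ` {0..<q}"
    then show "inj_on ?F {0..<q}" by (rule finite_surj_inj[rotated]) simp
  qed
  also have "\<dots> \<longleftrightarrow> (\<forall>c\<in>{0..<q}. \<exists>a\<in>{0..<q}. ?F a = c)"
    unfolding subset_iff image_iff by metis
  also have "\<dots> \<longleftrightarrow> (\<forall>c\<in>{0..<q}. \<exists>a. ?F a = c)"
  proof -
    have "?F (a mod q) = ?F a" for a
      using poly_cong_arg[of "a mod q" a q P] by (simp add: cong_def)
    moreover have "a mod q \<in> {0..<q}" for a using assms by simp
    ultimately show ?thesis by metis
  qed
  finally show ?thesis .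
qed

section \<open>Counting a residue class\<close>

text \<open>
  Each full block of \<open>q\<close> consecutive indices contains exactly one member of the class, and the
  incomplete last block at most one, whence the error does not depend on \<open>q\<close>.
\<close>

lemma card_residue_class:
  fixes q N :: nat and a :: int
  assumes q: "q > 0"
  shows "\<bar>real (card {n \<in> {1..N}. [int n = a] (mod int q)}) - real N / real q\<bar> \<le> 1"
proof -
  define S where "S = {n \<in> {1..N}. [int n = a] (mod int q)}"
  have fin: "finite S" by (simp add: S_def)
  have "inj_on (\<lambda>n. n div q) S"
  proof (rule inj_onI)
    fix m n assume "m \<in> S" "n \<in> S" and div: "m div q = n div q"
    then have "[int m = int n] (mod int q)" unfolding S_def by (auto intro: cong_trans cong_sym)
    then have "m mod q = n mod q" by (metis cong_int_iff cong_def)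
    with div show "m = n" by (metis div_mult_mod_eq)
  qed
  moreover have "(\<lambda>n. n div q) ` S \<subseteq> {..N div q}" by (auto simp: S_def div_le_mono)
  ultimately have "card S \<le> card {..N div q}" by (rule card_inj_on_le) simp
  then have upper: "card S \<le> N div q + 1" by simp
  \<comment> \<open>The representative of the class is taken in \<open>{1..q}\<close>, since the indices start at \<open>1\<close>.\<close>
  define r where "r = (if a mod int q = 0 then q else nat (a mod int q))"
  have pos: "0 \<le> a mod int q" "a mod int q < int q" using q by auto
  have r: "1 \<le> r" "r \<le> q" and rc: "[int r = a] (mod int q)"
  proof -
    show "1 \<le> r" "r \<le> q" using pos q by (simp_all only: r_def split: if_split) linarith+
    show "[int r = a] (mod int q)" using pos by (simp add: r_def cong_def)
  qed
  have "(\<lambda>j. q * j + r) ` {..<N div q} \<subseteq> S"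
  proof (rule image_subsetI)
    fix j assume "j \<in> {..<N div q}"
    then have "q * (j + 1) \<le> q * (N div q)" by (intro mult_le_mono) auto
    also have "\<dots> \<le> N" by simp
    finally have "q * j + r \<le> N" using r by simp
    moreover have "[int (q * j + r) = a] (mod int q)" using rc by (simp add: cong_def mod_simps)
    ultimately show "q * j + r \<in> S" using r by (auto simp: S_def)
  qed
  moreover have "inj_on (\<lambda>j. q * j + r) {..<N div q}" using q by (auto simp: inj_on_def)
  ultimately have "card {..<N div q} \<le> card S" using card_inj_on_le fin by blast
  then have lower: "N div q \<le> card S" by simp
  have "real (N div q) \<le> real N / real q" by (rule of_nat_div_le_of_nat)
  moreover have "real N / real q \<le> real (N div q) + 1"
  proof -
    have "N \<le> (N div q + 1) * q" using q dividend_less_div_times[of q N] by simp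
    then have "real N \<le> real ((N div q + 1) * q)" by (simp only: of_nat_le_iff)
    then show ?thesis using q by (simp add: divide_le_eq distrib_right)
  qed
  ultimately show ?thesis using upper lower unfolding S_def[symmetric] by linarith
qed

section \<open>Reduction of \<open>p\<close>-adic notions to residues\<close>

lemma padic_minus_residue_eq_0_iff:
  assumes p: "p > 0" and x: "x \<in> carrier (padic_ring p)" and y: "y \<in> carrier (padic_ring p)"
  shows "(x \<ominus>\<^bsub>padic_ring p\<^esub> y) k = 0 \<longleftrightarrow> x k = y k"
proof -
  interpret cring "padic_ring p" using p by (rule padic_cring)
  let ?d = "x \<ominus>\<^bsub>padic_ring p\<^esub> y"
  have d: "?d \<in> carrier (padic_ring p)" using x y by simp
  have "?d \<oplus>\<^bsub>padic_ring p\<^esub> y = x" using x y by (simp add: minus_eq a_assoc l_neg)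
  then have xk: "x k = (?d k + y k) mod int p ^ k" by (metis padic_simps(2))
  show ?thesis
  proof
    assume "?d k = 0"
    then show "x k = y k" using xk padic_residue[OF y] by simp
  next
    assume "x k = y k"
    then have "[?d k + y k = 0 + y k] (mod int p ^ k)"
      using xk padic_residue[OF y, of k] by (simp add: cong_def)
    then have "[?d k = 0] (mod int p ^ k)" by (simp only: cong_add_rcancel)
    then show "?d k = 0" using padic_residue[OF d, of k] by (simp add: cong_def)
  qed
qed

text \<open>
  The \<open>j\<close> with \<open>x j = 0\<close> are downward closed, and bounded when \<open>x\<close> is nonzero, so that the valuation
  is their maximum and \<open>x k = 0\<close> says that it is at least \<open>k\<close>.
\<close>

lemma padic_abs_le_iff:
  assumes p: "p > 1" and x: "x \<in> carrier (padic_ring p)"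
  shows "padic_abs p x \<le> 1 / real p ^ k \<longleftrightarrow> x k = 0"
proof (cases "x = \<zero>\<^bsub>padic_ring p\<^esub>")
  case True
  then show ?thesis by (simp add: padic_abs_def padic_simps)
next
  case False
  have p0: "p > 0" using p by simp
  obtain m where m: "x m \<noteq> 0" using False by (auto simp: padic_simps)
  have down: "x i = 0" if "x j = 0" "i \<le> j" for i j
    using padic_mod_le[OF x that(2)] that(1) by simp
  have bound: "j \<le> m" if "x j = 0" for j
    using down[OF that, of m] m by (metis nle_le)
  have val: "padic_val p x = (GREATEST j. x j = 0)"
    by (simp add: padic_val_def padic_power_divides_iff[OF p0 x])
  have x0: "x 0 = 0" using x[unfolded padic_carrier_iff, rule_format, of 0] by simp
  have "x (padic_val p x) = 0"
    unfolding val by (rule GreatestI_nat[of "\<lambda>j. x j = 0", OF x0 bound])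
  then have "x k = 0 \<longleftrightarrow> k \<le> padic_val p x"
    using down Greatest_le_nat[of "\<lambda>j. x j = 0", OF _ bound] unfolding val by blast
  moreover have "1 / real p ^ padic_val p x \<le> 1 / real p ^ k \<longleftrightarrow> k \<le> padic_val p x"
    using p by (simp add: divide_simps)
  ultimately show ?thesis using False by (simp add: padic_abs_def)
qed

lemma padic_disc_iff:
  assumes p: "p > 1" and x: "x \<in> carrier (padic_ring p)" and z: "z \<in> carrier (padic_ring p)"
  shows "x \<in> padic_disc p z (1 / real p ^ k) \<longleftrightarrow> x k = z k"
proof -
  have p0: "p > 0" using p by simp
  interpret cring "padic_ring p" using p0 by (rule padic_cring)
  show ?thesis
    using padic_abs_le_iff[OF p, of "x \<ominus>\<^bsub>padic_ring p\<^esub> z" k] x z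
    by (simp add: padic_disc_def padic_minus_residue_eq_0_iff[OF p0 x z])
qed

text \<open>Coefficient lists of \<open>\<int>\<^sub>p[x]\<close> start with the leading coefficient, those of \<open>Poly\<close> end
  with it.\<close>

definition residue_poly :: "nat \<Rightarrow> (nat \<Rightarrow> int) list \<Rightarrow> int poly" where
  "residue_poly k f = Poly (rev (map (\<lambda>c. c k) f))"

lemma poly_residue_poly_Nil: "poly (residue_poly k []) a = 0"
  by (simp add: residue_poly_def)

lemma poly_residue_poly_Cons:
  "poly (residue_poly k (c # f)) a = c k * a ^ length f + poly (residue_poly k f) a"
  by (simp add: residue_poly_def Poly_snoc poly_monom)

lemma padic_eval_residue:
  assumes p: "p > 0" and f: "set f \<subseteq> carrier (padic_ring p)" and x: "x \<in> carrier (padic_ring p)"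
  shows "ring.eval (padic_ring p) f x k = poly (residue_poly k f) (x k) mod int p ^ k"
proof -
  interpret cring "padic_ring p" using p by (rule padic_cring)
  have pow: "(x [^]\<^bsub>padic_ring p\<^esub> n) k = x k ^ n mod int p ^ k" for n
    by (induction n) (simp_all add: padic_simps mod_simps mult.commute)
  show ?thesis
  proof (induction f)
    case Nil
    then show ?case by (simp add: poly_residue_poly_Nil padic_simps)
  next
    case (Cons c f)
    have "(c k * (x k ^ n mod int p ^ k) + b) mod int p ^ k = (c k * x k ^ n + b) mod int p ^ k"
      for n b by (metis mod_add_left_eq mod_mult_right_eq)
    with Cons show ?case by (simp add: poly_residue_poly_Cons padic_simps pow mod_simps)
  qed
qed

lemma residue_poly_cong:
  assumes f: "set f \<subseteq> carrier (padic_ring p)" and "j \<le> k"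
  shows "[poly (residue_poly k f) a = poly (residue_poly j f) a] (mod int p ^ j)"
  using f
proof (induction f)
  case Nil
  then show ?case by (simp add: poly_residue_poly_Nil)
next
  case (Cons c f)
  have "[c k = c j] (mod int p ^ j)"
    using Cons.prems padic_mod_le[of c p j k] padic_residue[of c p j] assms(2)
    by (simp add: cong_def)
  with Cons show ?case
    unfolding poly_residue_poly_Cons by (intro cong_add cong_mult) auto
qed

lemma inj_mod_residue_poly_cong:
  assumes f: "set f \<subseteq> carrier (padic_ring p)" and "j \<le> k"
  shows "inj_mod (residue_poly k f) (int p ^ j) \<longleftrightarrow> inj_mod (residue_poly j f) (int p ^ j)"
  using residue_poly_cong[OF assms] unfolding inj_mod_def cong_def by simp

lemma padic_residue_surj:
  assumes "p > 0" and "a \<in> {0..<int p ^ k}"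
  obtains x where "x \<in> carrier (padic_ring p)" "x k = a"
proof
  show "padic_of_nat p (nat a) \<in> carrier (padic_ring p)"
    using assms(1) by (rule padic_of_nat_closed)
  show "padic_of_nat p (nat a) k = a"
    using assms by (simp add: padic_of_nat_eq)
qed

text \<open>
  Two \<open>p\<close>-adic integers have the same coset modulo \<open>p\<^sup>k\<int>\<^sub>p\<close> iff their \<open>k\<close>-th residues agree. So the
  quotient ring is finite, and bijectivity of a self-map is just injectivity.
\<close>

lemma perm_poly_mod_power_iff_inj_mod:
  assumes p: "p > 0" and f: "set f \<subseteq> carrier (padic_ring p)"
  shows "perm_poly_mod_power p f k \<longleftrightarrow> inj_mod (residue_poly k f) (int p ^ k)"
proof -
  let ?R = "padic_ring p" and ?q = "int p ^ k"
  interpret cring ?R using p by (rule padic_cring)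
  define I where "I = PIdl\<^bsub>?R\<^esub> (padic_of_nat p (p ^ k))"
  define F where "F = ring.eval (?R Quot I) (map (\<lambda>c. I +>\<^bsub>?R\<^esub> c) f)"
  have pk: "padic_of_nat p (p ^ k) \<in> carrier ?R" using p by (rule padic_of_nat_closed)
  have I: "ideal I ?R" unfolding I_def using pk by (rule cgenideal_ideal)
  have memI: "x \<in> I \<longleftrightarrow> x k = 0" if "x \<in> carrier ?R" for x
  proof -
    have "x \<in> I \<longleftrightarrow> padic_of_nat p (p ^ k) divides\<^bsub>?R\<^esub> x"
      using pk by (auto simp: I_def cgenideal_def factor_def m_comm)
    then show ?thesis using padic_power_divides_iff[OF p that] by simp
  qed
  have coset: "I +>\<^bsub>?R\<^esub> x = I +>\<^bsub>?R\<^esub> y \<longleftrightarrow> x k = y k"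
    if "x \<in> carrier ?R" "y \<in> carrier ?R" for x y
    using quotient_eq_iff_same_a_r_cos[OF I that] memI[of "x \<ominus>\<^bsub>?R\<^esub> y"] that
      padic_minus_residue_eq_0_iff[OF p that] by simp
  have car: "carrier (?R Quot I) = (\<lambda>x. I +>\<^bsub>?R\<^esub> x) ` carrier ?R"
    by (auto simp: FactRing_def A_RCOSETS_def')
  have evc: "eval f x \<in> carrier ?R" if "x \<in> carrier ?R" for x
    using eval_in_carrier[OF f that] .
  have F: "F (I +>\<^bsub>?R\<^esub> x) = I +>\<^bsub>?R\<^esub> eval f x" if "x \<in> carrier ?R" for x
    unfolding F_def using I f that by (rule eval_reduced_polynomial)
  have fin: "finite (carrier (?R Quot I))"
  proof -
    define rep where "rep = (\<lambda>a. I +>\<^bsub>?R\<^esub> padic_of_nat p (nat a))"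
    have "I +>\<^bsub>?R\<^esub> x \<in> rep ` {0..<?q}" if x: "x \<in> carrier ?R" for x
    proof
      have xk: "0 \<le> x k" "x k < ?q" using x by (auto simp: padic_carrier_iff)
      then show "x k \<in> {0..<?q}" by simp
      show "I +>\<^bsub>?R\<^esub> x = rep (x k)"
        unfolding rep_def
        by (subst coset[OF x padic_of_nat_closed[OF p]]) (simp add: padic_of_nat_eq[OF p] xk)
    qed
    then have "carrier (?R Quot I) \<subseteq> rep ` {0..<?q}" unfolding car by auto
    then show ?thesis by (rule finite_subset) simp
  qed
  have into: "F ` carrier (?R Quot I) \<subseteq> carrier (?R Quot I)" unfolding car using F evc by auto
  have "perm_poly_mod_power p f k \<longleftrightarrow> bij_betw F (carrier (?R Quot I)) (carrier (?R Quot I))"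
    by (simp add: perm_poly_mod_power_def Let_def F_def I_def)
  also have "\<dots> \<longleftrightarrow> inj_on F (carrier (?R Quot I))"
    using endo_inj_surj[OF fin into] by (auto simp: bij_betw_def)
  also have "\<dots> \<longleftrightarrow> (\<forall>x\<in>carrier ?R. \<forall>y\<in>carrier ?R. eval f x k = eval f y k \<longrightarrow> x k = y k)"
    by (simp add: car inj_on_def F coset evc)
  also have "\<dots> \<longleftrightarrow> (\<forall>a\<in>{0..<?q}. \<forall>b\<in>{0..<?q}.
      poly (residue_poly k f) a mod ?q = poly (residue_poly k f) b mod ?q \<longrightarrow> a = b)"
    (is "?A \<longleftrightarrow> ?B")
  proof
    assume ?A
    then show ?B using padic_residue_surj[OF p, of _ k]
      by (metis padic_eval_residue[OF p f])
  next
    assume ?B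
    then show ?A by (auto simp: padic_eval_residue[OF p f] padic_carrier_iff)
  qed
  also have "\<dots> \<longleftrightarrow> inj_mod (residue_poly k f) ?q"
    using p by (simp add: inj_mod_iff_inj_on inj_on_def)
  finally show ?thesis .
qed

section \<open>The discrepancy\<close>

definition local_discrepancy ::
    "nat \<Rightarrow> (nat \<Rightarrow> (nat \<Rightarrow> int)) \<Rightarrow> nat \<Rightarrow> (nat \<Rightarrow> int) \<Rightarrow> nat \<Rightarrow> real" where
  "local_discrepancy p x N z k =
     \<bar>real (card {n \<in> {1..N}. x n \<in> padic_disc p z (1 / real p ^ k)}) / real N
        - 1 / real p ^ k\<bar>"

lemma local_discrepancy_le_1:
  assumes "p > 0"
  shows "local_discrepancy p x N z k \<le> 1"
proof -
  let ?c = "card {n \<in> {1..N}. x n \<in> padic_disc p z (1 / real p ^ k)}"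
  have "?c \<le> card {1..N}" by (rule card_mono) auto
  then have "real ?c / real N \<le> 1" by (cases "N = 0") simp_all
  moreover have "1 / real p ^ k \<le> 1" using assms by (simp add: divide_le_eq_1)
  moreover have "real ?c / real N \<ge> 0" "1 / real p ^ k \<ge> 0" by simp_all
  ultimately show ?thesis unfolding local_discrepancy_def by linarith
qed

lemma local_discrepancy_le_padic_discrepancy:
  assumes "p > 0" and "z \<in> carrier (padic_ring p)" and "k \<ge> 1"
  shows "local_discrepancy p x N z k \<le> padic_discrepancy p x N"
proof -
  have "bdd_above ((\<lambda>(z, k). local_discrepancy p x N z k) ` (carrier (padic_ring p) \<times> {1..}))"
    using local_discrepancy_le_1[OF assms(1)] by (auto intro!: bdd_aboveI[of _ 1])
  then have "(\<lambda>(z, k). local_discrepancy p x N z k) (z, k) \<le> padic_discrepancy p x N"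
    unfolding padic_discrepancy_def local_discrepancy_def
    by (rule cSUP_upper[rotated]) (use assms in auto)
  then show ?thesis by simp
qed

lemma padic_discrepancy_nonneg:
  assumes "p > 0"
  shows "padic_discrepancy p x N \<ge> 0"
proof -
  have "0 \<le> local_discrepancy p x N (padic_of_nat p 0) 1" by (simp add: local_discrepancy_def)
  also have "\<dots> \<le> padic_discrepancy p x N"
    using assms by (intro local_discrepancy_le_padic_discrepancy padic_of_nat_closed) auto
  finally show ?thesis .
qed

lemma padic_discrepancy_leI:
  assumes "p > 0"
    and "\<And>z k. z \<in> carrier (padic_ring p) \<Longrightarrow> k \<ge> 1 \<Longrightarrow> local_discrepancy p x N z k \<le> B"
  shows "padic_discrepancy p x N \<le> B"
proof -
  have ne: "carrier (padic_ring p) \<times> {1::nat..} \<noteq> {}"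
    using padic_of_nat_closed[OF assms(1)] by auto
  show ?thesis
    unfolding padic_discrepancy_def
    by (rule cSUP_least[OF ne]) (use assms(2) in \<open>auto simp: local_discrepancy_def\<close>)
qed

lemma polynomial_sequence_in_disc_iff:
  assumes p: "p > 1" and f: "set f \<subseteq> carrier (padic_ring p)" and z: "z \<in> carrier (padic_ring p)"
  shows "ring.eval (padic_ring p) f (padic_of_nat p n) \<in> padic_disc p z (1 / real p ^ k)
    \<longleftrightarrow> poly (residue_poly k f) (int n) mod int p ^ k = z k"
proof -
  have p0: "p > 0" using p by simp
  interpret cring "padic_ring p" using p0 by (rule padic_cring)
  have n: "padic_of_nat p n \<in> carrier (padic_ring p)" using p0 by (rule padic_of_nat_closed)
  have "[poly (residue_poly k f) (int n mod int p ^ k) = poly (residue_poly k f) (int n)]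
      (mod int p ^ k)"
    by (rule poly_cong_arg) simp
  then show ?thesis
    unfolding padic_disc_iff[OF p eval_in_carrier[OF f n] z] padic_eval_residue[OF p0 f n]
    by (simp add: padic_of_nat_eq[OF p0] cong_def)
qed

lemma padic_discrepancy_ge_if_not_inj_mod:
  assumes p: "p > 1" and f: "set f \<subseteq> carrier (padic_ring p)" and k: "k \<ge> 1"
    and "\<not> inj_mod (residue_poly k f) (int p ^ k)"
  shows "1 / real p ^ k
    \<le> padic_discrepancy p (\<lambda>n. ring.eval (padic_ring p) f (padic_of_nat p n)) N"
proof -
  have p0: "p > 0" using p by simp
  obtain c where c: "c \<in> {0..<int p ^ k}" "\<And>a. poly (residue_poly k f) a mod int p ^ k \<noteq> c"
    using assms(4) p0 by (auto simp: inj_mod_iff_surj)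
  obtain z where z: "z \<in> carrier (padic_ring p)" "z k = c"
    using padic_residue_surj[OF p0 c(1)] .
  have "1 / real p ^ k =
      local_discrepancy p (\<lambda>n. ring.eval (padic_ring p) f (padic_of_nat p n)) N z k"
    unfolding local_discrepancy_def polynomial_sequence_in_disc_iff[OF p f z(1)]
    using c(2) z(2) by simp
  also have "\<dots> \<le> padic_discrepancy p (\<lambda>n. ring.eval (padic_ring p) f (padic_of_nat p n)) N"
    using p0 z(1) k by (rule local_discrepancy_le_padic_discrepancy)
  finally show ?thesis .
qed

lemma local_discrepancy_le_if_inj_mod:
  assumes p: "p > 1" and f: "set f \<subseteq> carrier (padic_ring p)"
    and inj: "inj_mod (residue_poly k f) (int p ^ k)"
    and z: "z \<in> carrier (padic_ring p)" and N: "N \<ge> 1"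
  shows "local_discrepancy p (\<lambda>n. ring.eval (padic_ring p) f (padic_of_nat p n)) N z k
    \<le> 1 / real N"
proof -
  let ?P = "residue_poly k f" and ?q = "int p ^ k"
  have q: "?q > 0" using p by simp
  have "z k \<in> {0..<?q}" using z by (auto simp: padic_carrier_iff)
  then obtain a where a: "poly ?P a mod ?q = z k"
    using inj unfolding inj_mod_iff_surj[OF q] by blast
  have "poly ?P (int n) mod ?q = z k \<longleftrightarrow> [int n = a] (mod ?q)" for n
    using inj poly_cong_arg[of "int n" a ?q ?P] unfolding inj_mod_def a[symmetric] cong_def
    by blast
  then have eq: "{n \<in> {1..N}. ring.eval (padic_ring p) f (padic_of_nat p n)
        \<in> padic_disc p z (1 / real p ^ k)} = {n \<in> {1..N}. [int n = a] (mod int (p ^ k))}"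
    (is "?S = ?T")
    by (simp add: polynomial_sequence_in_disc_iff[OF p f z])
  have "\<bar>real (card ?T) / real N - 1 / real p ^ k\<bar>
      = \<bar>real (card ?T) - real N / real (p ^ k)\<bar> / real N"
  proof -
    have "real (card ?T) / real N - 1 / real p ^ k
        = (real (card ?T) - real N / real (p ^ k)) / real N"
      using N by (simp add: diff_divide_distrib)
    then show ?thesis by (simp only: abs_divide abs_of_nat)
  qed
  also have "\<dots> \<le> 1 / real N"
    using card_residue_class[of "p ^ k" N a] p by (intro divide_right_mono) auto
  finally show ?thesis unfolding local_discrepancy_def eq .
qed

theorem theorem1p2:
  fixes p :: nat and f :: "(nat \<Rightarrow> int) list"
  assumes "Factorial_Ring.prime p"
    and "f \<in> carrier (univ_poly (padic_ring p) (carrier (padic_ring p)))"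
  shows "(\<lambda>N. padic_discrepancy p
                (\<lambda>n. ring.eval (padic_ring p) f (padic_of_nat p n)) N) \<in> O(\<lambda>N. 1 / real N)
         \<longleftrightarrow> perm_poly_mod_power p f 1 \<and> perm_poly_mod_power p f 2"
    (is "?D \<in> _ \<longleftrightarrow> _")
proof -
  have p: "p > 1" using assms(1) by (rule prime_gt_1_nat)
  then have p0: "p > 0" by simp
  have f: "set f \<subseteq> carrier (padic_ring p)"
    using assms(2) by (auto simp: univ_poly_def polynomial_def)
  note perm_iff = perm_poly_mod_power_iff_inj_mod[OF p0 f]
  show ?thesis
  proof
    assume O: "?D \<in> O(\<lambda>N. 1 / real N)"
    have "perm_poly_mod_power p f k" if k: "k \<ge> 1" for k
    proof (rule ccontr)
      assume "\<not> perm_poly_mod_power p f k"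
      then have ge: "1 / real p ^ k \<le> ?D N" for N
        using padic_discrepancy_ge_if_not_inj_mod[OF p f k] by (simp add: perm_iff)
      have "(\<lambda>N. 1 / real N) \<in> o(\<lambda>_. 1)"
        by (rule smalloI_tendsto) (simp_all add: lim_1_over_n)
      with O have "?D \<in> o(\<lambda>_. 1)" by (rule landau_o.big_small_trans)
      then have "?D \<longlonglongrightarrow> 0" using smalloD_tendsto by fastforce
      then have "1 / real p ^ k \<le> 0" by (rule tendsto_lowerbound) (use ge in auto)
      moreover have "1 / real p ^ k > 0" using p0 by simp
      ultimately show False by linarith
    qed
    then show "perm_poly_mod_power p f 1 \<and> perm_poly_mod_power p f 2" by simp
  next
    assume "perm_poly_mod_power p f 1 \<and> perm_poly_mod_power p f 2"
    then have inj12: "inj_mod (residue_poly 1 f) (int p ^ 1)" "inj_mod (residue_poly 2 f) (int p ^ 2)"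
      by (simp_all only: perm_iff)
    have inj: "inj_mod (residue_poly k f) (int p ^ k)" if k: "k \<ge> 1" for k
    proof -
      \<comment> \<open>Lifting needs one integer polynomial for all the moduli \<open>p\<close>, \<open>p ^ 2\<close> and \<open>p ^ k\<close>.\<close>
      let ?P = "residue_poly (k + 2) f"
      have cong: "inj_mod ?P (int p ^ j) \<longleftrightarrow> inj_mod (residue_poly j f) (int p ^ j)"
        if "j \<le> k + 2" for j
        using inj_mod_residue_poly_cong[OF f that] .
      have "inj_mod ?P (int p ^ 1)" "inj_mod ?P (int p ^ 2)"
        using inj12 cong[of 1] cong[of 2] k by simp_all
      then have "inj_mod ?P (int p ^ k)"
        using k by (rule inj_mod_all_prime_powers[OF assms(1)])
      then show ?thesis using cong[of k] by simp
    qed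
    have "?D N \<le> 1 / real N" if N: "N \<ge> 1" for N
      using p0 local_discrepancy_le_if_inj_mod[OF p f inj _ N] by (rule padic_discrepancy_leI)
    then have "norm (?D N) \<le> 1 * norm (1 / real N)" if "N \<ge> 1" for N
      using padic_discrepancy_nonneg[OF p0] that by simp
    then show "?D \<in> O(\<lambda>N. 1 / real N)"
      by (intro bigoI[of _ 1]) (auto intro: eventually_sequentiallyI[of 1])
  qed
qed

end
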